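(* Let $\mathrm{R}$ be a retraction on a Riemannian manifold $\mathcal{M}$, and let $\mathcal{U}$ be a nonempty compact subset of $\mathcal{M}$. For any $b\in(0,1)$ there exists $a>0$ such that, for all $x\in\mathcal{U}$ and $s\in\mathrm{T}_x\mathcal{M}$ with $\|s\|_x\le a$, we have $\sigma_{\min}(\mathrm{D}\mathrm{R}_x(s))\ge b$. In particular, for any sequence of points $x_0,x_1,x_2,\ldots$ (such as iterates of an optimization algorithm) remaining in $\mathcal{U}$ and any tangent vectors $s_k\in\mathrm{T}_{x_k}\mathcal{M}$, such $(a,b)$ satisfy: for each $k$, if $\|s_k\|\le a$, then $\sigma_{\min}(\mathrm{D}\mathrm{R}_{x_k}(s_k))\ge b$.
   Context: $\mathrm{T}_x\mathcal{M}$ is the tangent space at $x$ with Riemannian norm $\|\cdot\|_x$, and $\mathrm{T}\mathcal{M}$ is the tangent bundle. A retraction is a smooth map $\mathrm{R}\colon\mathrm{T}\mathcal{M}\to\mathcal{M}$, $(x,s)\mapsto\mathrm{R}_x(s)$, such that for each $x$, $\mathrm{R}_x(0)=x$ and $\mathrm{D}\mathrm{R}_x(0)$ is the identity on $\mathrm{T}_x\mathcal{M}$. $\mathrm{D}\mathrm{R}_x(s)\colon\mathrm{T}_x\mathcal{M}\to\mathrm{T}_{\mathrm{R}_x(s)}\mathcal{M}$ is the differential of $\mathrm{R}_x$ at $s$, and $\sigma_{\min}$ denotes the smallest singular value with respect to the Riemannian metrics on these tangent spaces. *)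

theory Defs
  imports "HOL-Analysis.Analysis" "HOL-Library.Function_Algebras"
begin

instantiation "fun" :: (type, real_vector) real_vector
begin

definition scaleR_fun :: "real \<Rightarrow> ('a \<Rightarrow> 'b) \<Rightarrow> 'a \<Rightarrow> 'b"
  where "scaleR_fun r f = (\<lambda>x. r *\<^sub>R f x)"

instance
  by standard (simp_all add: scaleR_fun_def fun_eq_iff scaleR_add_right scaleR_add_left)

end


section \<open>Smooth maps between vector spaces\<close>

text \<open>Intended for open \<open>S\<close> in finite dimension: there, existence and continuity of all iterated
  directional derivatives is the usual notion of class \<open>C\<^sup>k\<close>.\<close>

primrec Ck_on ::
    "nat \<Rightarrow> 'a::real_normed_vector set \<Rightarrow> ('a \<Rightarrow> 'b::real_normed_vector) \<Rightarrow> bool" where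
  "Ck_on 0 S f \<longleftrightarrow> continuous_on S f"
| "Ck_on (Suc k) S f \<longleftrightarrow>
     (\<forall>x\<in>S. f differentiable (at x)) \<and> (\<forall>v. Ck_on k S (\<lambda>x. frechet_derivative f (at x) v))"

definition smooth_on :: "'a::real_normed_vector set \<Rightarrow> ('a \<Rightarrow> 'b::real_normed_vector) \<Rightarrow> bool"
  where "smooth_on S f \<longleftrightarrow> (\<forall>k. Ck_on k S f)"


section \<open>Smooth manifolds\<close>

text \<open>A manifold is given by an atlas; its underlying set is the union of the chart domains and
  its topology is the one induced by the atlas. A chart \<open>(U, \<phi>)\<close> uses only the values of \<open>\<phi>\<close>
  on \<open>U\<close>. The dimension of the manifold is \<open>DIM('e)\<close>.\<close>

type_synonym ('a, 'e) chart = "'a set \<times> ('a \<Rightarrow> 'e)"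
type_synonym ('a, 'e) atlas = "('a, 'e) chart set"

abbreviation chart_dom :: "('a, 'e) chart \<Rightarrow> 'a set"
  where "chart_dom \<equiv> fst"

abbreviation chart_coord :: "('a, 'e) chart \<Rightarrow> 'a \<Rightarrow> 'e"
  where "chart_coord \<equiv> snd"

definition param :: "('a, 'e) chart \<Rightarrow> 'e \<Rightarrow> 'a"
  where "param c = inv_into (chart_dom c) (chart_coord c)"

definition points :: "('a, 'e) atlas \<Rightarrow> 'a set"
  where "points A = (\<Union>c\<in>A. chart_dom c)"

definition is_chart :: "('a, 'e::euclidean_space) chart \<Rightarrow> bool"
  where "is_chart c \<longleftrightarrow> inj_on (chart_coord c) (chart_dom c) \<and> open (chart_coord c ` chart_dom c)"

definition transition :: "('a, 'e) chart \<Rightarrow> ('a, 'e) chart \<Rightarrow> 'e \<Rightarrow> 'e"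
  where "transition c d = chart_coord d \<circ> param c"

definition compatible ::
    "('a, 'e::euclidean_space) chart \<Rightarrow> ('a, 'e) chart \<Rightarrow> bool"
  where "compatible c d \<longleftrightarrow>
    open (chart_coord c ` (chart_dom c \<inter> chart_dom d)) \<and> smooth_on (chart_coord c ` (chart_dom c \<inter> chart_dom d)) (transition c d)"

definition smooth_atlas :: "('a, 'e::euclidean_space) atlas \<Rightarrow> bool"
  where "smooth_atlas A \<longleftrightarrow> (\<forall>c\<in>A. is_chart c) \<and> (\<forall>c\<in>A. \<forall>d\<in>A. compatible c d)"

definition atlas_topology :: "('a, 'e::euclidean_space) atlas \<Rightarrow> 'a topology"
  where "atlas_topology A =
    topology (\<lambda>W. W \<subseteq> points A \<and> (\<forall>c\<in>A. open (chart_coord c ` (W \<inter> chart_dom c))))"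

lemma openin_atlas_topology:
  assumes "\<And>c. c \<in> A \<Longrightarrow> is_chart c"
  shows "openin (atlas_topology A) W \<longleftrightarrow>
    W \<subseteq> points A \<and> (\<forall>c\<in>A. open (chart_coord c ` (W \<inter> chart_dom c)))"
proof -
  have "istopology (\<lambda>W. W \<subseteq> points A \<and> (\<forall>c\<in>A. open (chart_coord c ` (W \<inter> chart_dom c))))"
    unfolding istopology_def
  proof (intro conjI allI impI ballI)
    fix S T c
    assume S: "S \<subseteq> points A \<and> (\<forall>c\<in>A. open (chart_coord c ` (S \<inter> chart_dom c)))"
      and T: "T \<subseteq> points A \<and> (\<forall>c\<in>A. open (chart_coord c ` (T \<inter> chart_dom c)))"
    show "S \<inter> T \<subseteq> points A"
      using S by blast
    assume c: "c \<in> A"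
    then have "inj_on (chart_coord c) (chart_dom c)"
      using assms is_chart_def by blast
    then have "chart_coord c ` (S \<inter> T \<inter> chart_dom c) = chart_coord c ` (S \<inter> chart_dom c) \<inter> chart_coord c ` (T \<inter> chart_dom c)"
      by (auto simp: inj_on_def)
    then show "open (chart_coord c ` (S \<inter> T \<inter> chart_dom c))"
      using S T c by auto
  next
    fix \<W> c
    assume W: "\<forall>W\<in>\<W>. W \<subseteq> points A \<and> (\<forall>c\<in>A. open (chart_coord c ` (W \<inter> chart_dom c)))"
    show "\<Union>\<W> \<subseteq> points A"
      using W by blast
    assume c: "c \<in> A"
    have "chart_coord c ` (\<Union>\<W> \<inter> chart_dom c) = (\<Union>W\<in>\<W>. chart_coord c ` (W \<inter> chart_dom c))"
      by blast
    then show "open (chart_coord c ` (\<Union>\<W> \<inter> chart_dom c))"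
      using W c by auto
  qed
  then show ?thesis
    by (simp add: atlas_topology_def)
qed

definition smooth_manifold :: "('a, 'e::euclidean_space) atlas \<Rightarrow> bool"
  where "smooth_manifold A \<longleftrightarrow>
    smooth_atlas A \<and> Hausdorff_space (atlas_topology A) \<and> second_countable (atlas_topology A)"

definition smooth_map ::
    "('a, 'e::euclidean_space) atlas \<Rightarrow> ('b, 'f::euclidean_space) atlas \<Rightarrow> ('a \<Rightarrow> 'b) \<Rightarrow> bool"
  where "smooth_map A B f \<longleftrightarrow>
    continuous_map (atlas_topology A) (atlas_topology B) f \<and>
    (\<forall>c\<in>A. \<forall>d\<in>B. smooth_on (chart_coord c ` (chart_dom c \<inter> f -` chart_dom d)) (chart_coord d \<circ> f \<circ> param c))"


section \<open>Tangent vectors and the tangent bundle\<close>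

text \<open>A tangent vector at \<open>x\<close> is represented by the family of its coordinate vectors in all charts
  around \<open>x\<close>, related to one another by the derivatives of the transition maps; entries at charts
  not containing \<open>x\<close> are set to zero. The vector space operations are pointwise.\<close>

type_synonym ('a, 'e) tangent = "('a, 'e) chart \<Rightarrow> 'e"

definition tangent_space :: "('a, 'e::euclidean_space) atlas \<Rightarrow> 'a \<Rightarrow> ('a, 'e) tangent set"
  where "tangent_space A x = {v.
    (\<forall>c\<in>A. \<forall>d\<in>A. x \<in> chart_dom c \<inter> chart_dom d \<longrightarrow>
        v d = frechet_derivative (transition c d) (at (chart_coord c x)) (v c)) \<and>
    (\<forall>c. \<not> (c \<in> A \<and> x \<in> chart_dom c) \<longrightarrow> v c = 0)}"

text \<open>The tangent vector at \<open>x\<close> with coordinate vector in the chart \<open>c\<close> equal to \<open>a\<close>.\<close>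

definition chart_vector ::
    "('a, 'e::euclidean_space) atlas \<Rightarrow> ('a, 'e) chart \<Rightarrow> 'a \<Rightarrow> 'e \<Rightarrow> ('a, 'e) tangent"
  where "chart_vector A c x a = (\<lambda>d. if d \<in> A \<and> x \<in> chart_dom d
    then frechet_derivative (transition c d) (at (chart_coord c x)) a else 0)"

definition bundle_chart ::
    "('a, 'e::euclidean_space) atlas \<Rightarrow> ('a, 'e) chart \<Rightarrow> ('a \<times> ('a, 'e) tangent, 'e \<times> 'e) chart"
  where "bundle_chart A c =
    (SIGMA x:chart_dom c. tangent_space A x, \<lambda>(x, v). (chart_coord c x, v c))"

definition tangent_bundle ::
    "('a, 'e::euclidean_space) atlas \<Rightarrow> ('a \<times> ('a, 'e) tangent, 'e \<times> 'e) atlas"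
  where "tangent_bundle A = bundle_chart A ` A"

definition velocity ::
    "('a, 'e::euclidean_space) atlas \<Rightarrow> (real \<Rightarrow> 'a) \<Rightarrow> real \<Rightarrow> ('a, 'e) tangent"
  where "velocity A \<gamma> t = (\<lambda>d. if d \<in> A \<and> \<gamma> t \<in> chart_dom d
    then vector_derivative (chart_coord d \<circ> \<gamma>) (at t) else 0)"


section \<open>Riemannian metrics\<close>

definition inner_product_on :: "'v::real_vector set \<Rightarrow> ('v \<Rightarrow> 'v \<Rightarrow> real) \<Rightarrow> bool"
  where "inner_product_on E g \<longleftrightarrow>
    (\<forall>u\<in>E. \<forall>v\<in>E. g u v = g v u) \<and>
    (\<forall>u\<in>E. \<forall>v\<in>E. \<forall>w\<in>E. g (u + v) w = g u w + g v w) \<and>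
    (\<forall>r. \<forall>u\<in>E. \<forall>v\<in>E. g (r *\<^sub>R u) v = r * g u v) \<and>
    (\<forall>u\<in>E. u \<noteq> 0 \<longrightarrow> g u u > 0)"

type_synonym ('a, 'e) metric = "'a \<Rightarrow> ('a, 'e) tangent \<Rightarrow> ('a, 'e) tangent \<Rightarrow> real"

definition riemannian_metric :: "('a, 'e::euclidean_space) atlas \<Rightarrow> ('a, 'e) metric \<Rightarrow> bool"
  where "riemannian_metric A g \<longleftrightarrow>
    (\<forall>x\<in>points A. inner_product_on (tangent_space A x) (g x)) \<and>
    (\<forall>c\<in>A. \<forall>a b. smooth_on (chart_coord c ` chart_dom c)
      (\<lambda>y. g (param c y) (chart_vector A c (param c y) a) (chart_vector A c (param c y) b)))"

definition riemannian_manifold :: "('a, 'e::euclidean_space) atlas \<Rightarrow> ('a, 'e) metric \<Rightarrow> bool"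
  where "riemannian_manifold A g \<longleftrightarrow> smooth_manifold A \<and> riemannian_metric A g"

definition riemannian_norm :: "('a, 'e) metric \<Rightarrow> 'a \<Rightarrow> ('a, 'e) tangent \<Rightarrow> real"
  where "riemannian_norm g x s = sqrt (g x s s)"


section \<open>Singular values\<close>

text \<open>The adjoint of a linear map \<open>L\<close> from \<open>E\<close> with inner product \<open>g\<close> to \<open>F\<close> with inner
  product \<open>h\<close>; in finite dimension it exists and is unique on \<open>F\<close>.\<close>

definition adjoint_on ::
    "'v set \<Rightarrow> ('v \<Rightarrow> 'v \<Rightarrow> real) \<Rightarrow> 'w set \<Rightarrow> ('w \<Rightarrow> 'w \<Rightarrow> real) \<Rightarrow> ('v \<Rightarrow> 'w) \<Rightarrow> 'w \<Rightarrow> 'v"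
  where "adjoint_on E g F h L =
    (SOME L'. \<forall>w\<in>F. L' w \<in> E \<and> (\<forall>v\<in>E. h (L v) w = g v (L' w)))"

text \<open>Square roots of the eigenvalues of the operator \<open>L\<^sup>* L\<close> on \<open>E\<close>. This is the full list of
  singular values when \<open>dim E \<le> dim F\<close>.\<close>

definition singular_value ::
    "'v::real_vector set \<Rightarrow> ('v \<Rightarrow> 'v \<Rightarrow> real) \<Rightarrow> 'w set \<Rightarrow> ('w \<Rightarrow> 'w \<Rightarrow> real) \<Rightarrow> ('v \<Rightarrow> 'w) \<Rightarrow> real \<Rightarrow> bool"
  where "singular_value E g F h L \<sigma> \<longleftrightarrow>
    \<sigma> \<ge> 0 \<and> (\<exists>v\<in>E. v \<noteq> 0 \<and> adjoint_on E g F h L (L v) = \<sigma>\<^sup>2 *\<^sub>R v)"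

definition sigma_min ::
    "'v::real_vector set \<Rightarrow> ('v \<Rightarrow> 'v \<Rightarrow> real) \<Rightarrow> 'w set \<Rightarrow> ('w \<Rightarrow> 'w \<Rightarrow> real) \<Rightarrow> ('v \<Rightarrow> 'w) \<Rightarrow> real"
  where "sigma_min E g F h L = (LEAST \<sigma>. singular_value E g F h L \<sigma>)"


section \<open>Retractions\<close>

text \<open>The differential of \<open>R\<^sub>x\<close> at \<open>s\<close>, with the tangent space at \<open>s\<close> of the vector space of
  tangent vectors at \<open>x\<close> identified with that vector space; the direction \<open>u\<close> is represented by
  the curve \<open>t \<mapsto> s + t u\<close>.\<close>

definition retraction_diff ::
    "('a, 'e::euclidean_space) atlas \<Rightarrow> ('a \<times> ('a, 'e) tangent \<Rightarrow> 'a) \<Rightarrow> 'a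
      \<Rightarrow> ('a, 'e) tangent \<Rightarrow> ('a, 'e) tangent \<Rightarrow> ('a, 'e) tangent"
  where "retraction_diff A R x s u = velocity A (\<lambda>t. R (x, s + t *\<^sub>R u)) 0"

definition manifold_retraction ::
    "('a, 'e::euclidean_space) atlas \<Rightarrow> ('a \<times> ('a, 'e) tangent \<Rightarrow> 'a) \<Rightarrow> bool"
  where "manifold_retraction A R \<longleftrightarrow>
    smooth_map (tangent_bundle A) A R \<and>
    (\<forall>x\<in>points A. R (x, 0) = x \<and> (\<forall>u\<in>tangent_space A x. retraction_diff A R x 0 u = u))"

definition sigma_min_diff ::
    "('a, 'e::euclidean_space) atlas \<Rightarrow> ('a, 'e) metric \<Rightarrow> ('a \<times> ('a, 'e) tangent \<Rightarrow> 'a) \<Rightarrow> 'a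
      \<Rightarrow> ('a, 'e) tangent \<Rightarrow> real"
  where "sigma_min_diff A g R x s =
    sigma_min (tangent_space A x) (g x)
      (tangent_space A (R (x, s))) (g (R (x, s))) (retraction_diff A R x s)"

end

theory Submission
  imports Defs
begin

text \<open>In a chart \<open>c\<close> around \<open>x\<close> the differential \<open>D R\<^sub>y(v)\<close> becomes a linear map \<open>M(y, v)\<close> depending
  continuously on base point and fibre coordinate, with \<open>M(y, 0) = id\<close>. The function
  \<open>\<bar>M(y, v) w\<bar>\<^sup>2 - b\<^sup>2 \<bar>w\<bar>\<^sup>2\<close>, with the norms of the metric at \<open>R\<^sub>y(v)\<close> and at \<open>y\<close>, is therefore continuous, and
  at \<open>(x, 0)\<close> it equals \<open>(1 - b\<^sup>2) \<bar>w\<bar>\<^sup>2 > 0\<close>. By compactness of the Euclidean unit sphere it stays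
  positive for all unit \<open>w\<close> and all \<open>(y, v)\<close> near \<open>(x, 0)\<close>, and finitely many such neighbourhoods
  cover the compact set.\<close>

section \<open>The smallest singular value\<close>

text \<open>\<open>T\<close> is the Gram operator, with \<open>G a z\<close> equal to the Euclidean
  inner product of \<open>a\<close> and \<open>T z\<close>. A kernel vector \<open>z\<close> of
  \<open>T\<close> has \<open>G z z = 0\<close>, so positivity makes \<open>T\<close> injective, and
  finite dimension makes it surjective; \<open>z\<close> is a preimage of the Euclidean
  representative of \<open>f\<close>. This produces the adjoint of \<open>L\<close> below.\<close>

lemma riesz_positive_definite:
  fixes G :: "'e::euclidean_space \<Rightarrow> 'e \<Rightarrow> real"
  assumes "bilinear G" and pos: "\<And>a. a \<noteq> 0 \<Longrightarrow> G a a > 0" and "linear f"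
  obtains z where "\<And>a. f a = G a z"
proof -
  have lin: "linear (\<lambda>a. G a z)" "linear (G z)" for z
    using assms(1) by (auto simp: bilinear_def)
  define T where "T z = (\<Sum>b\<in>Basis. G b z *\<^sub>R b)" for z
  have represent: "k a = a \<bullet> (\<Sum>b\<in>Basis. k b *\<^sub>R b)" if "linear k" for k :: "'e \<Rightarrow> real" and a
  proof -
    have "k a = k (\<Sum>b\<in>Basis. (a \<bullet> b) *\<^sub>R b)"
      by (simp add: euclidean_representation)
    also have "\<dots> = (\<Sum>b\<in>Basis. (a \<bullet> b) * k b)"
      using that by (simp add: linear_sum linear_scale)
    finally show ?thesis
      by (simp add: inner_sum_right mult.commute)
  qed
  have T: "G a z = a \<bullet> T z" for a z
    unfolding T_def by (rule represent[OF lin(1)])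
  have "linear T"
    unfolding T_def using lin(2)
    by (intro linearI) (simp_all add: linear_add linear_scale scaleR_add_left sum.distrib scaleR_sum_right)
  moreover have "inj T"
    unfolding linear_injective_0[OF \<open>linear T\<close>]
    by (metis T inner_zero_right less_irrefl pos)
  ultimately have "surj T"
    by (rule linear_inj_imp_surj)
  then obtain z where z: "T z = (\<Sum>b\<in>Basis. f b *\<^sub>R b)"
    by (metis surjD)
  have "f a = G a z" for a
    unfolding T z by (rule represent[OF \<open>linear f\<close>])
  then show thesis by (rule that)
qed

text \<open>The quadratic \<open>P (a + t u) (a + t u)\<close> in \<open>t\<close> is nonnegative
  and vanishes at \<open>t = 0\<close>, so its slope \<open>2 * P a u\<close> there must be zero.
  This turns minimality of a quotient of quadratic forms into an eigenvalue equation.\<close>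

lemma psd_form_null:
  fixes P :: "'e::real_vector \<Rightarrow> 'e \<Rightarrow> real"
  assumes "bilinear P" and sym: "\<And>u v. P u v = P v u" and psd: "\<And>u. P u u \<ge> 0" and "P a a = 0"
  shows "P a u = 0"
proof -
  have lin: "P (x + y) z = P x z + P y z" "P z (x + y) = P z x + P z y"
    "P (r *\<^sub>R x) z = r * P x z" "P z (r *\<^sub>R x) = r * P z x" for x y z r
    using assms(1) by (simp_all add: bilinear_ladd bilinear_radd bilinear_lmul bilinear_rmul)
  have *: "0 \<le> 2 * t * P a u + t\<^sup>2 * P u u" for t
    using psd[of "a + t *\<^sub>R u"] assms(4) sym[of u a]
    by (simp add: lin power2_eq_square algebra_simps)
  \<comment> \<open>The added 1 keeps \<open>q\<close> positive even if \<open>P u u = 0\<close>, so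
    that the single choice \<open>t = - P a u / q\<close> serves both cases.\<close>
  define q where "q = P u u + 1"
  have "q > 0" using psd[of u] by (simp add: q_def)
  have "0 \<le> 2 * (- P a u / q) * P a u + (- P a u / q)\<^sup>2 * P u u"
    by (rule *)
  also have "\<dots> \<le> - (P a u)\<^sup>2 / q"
  proof -
    have "(- P a u / q)\<^sup>2 * P u u \<le> (- P a u / q)\<^sup>2 * q"
      by (intro mult_left_mono) (auto simp: q_def)
    also have "\<dots> = (P a u)\<^sup>2 / q"
      using \<open>q > 0\<close> by (simp add: power2_eq_square)
    finally show ?thesis
      by (simp add: power2_eq_square)
  qed
  finally show ?thesis
    using \<open>q > 0\<close> by (simp add: divide_le_0_iff)
qed

text \<open>The smallest singular value is the minimum of the quotient of norms of \<open>L v\<close> and \<open>v\<close>;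
  a minimiser is an eigenvector of \<open>L\<^sup>* L\<close>, so the \<open>LEAST\<close> is attained.\<close>

lemma sigma_min_ge:
  fixes i :: "'e::euclidean_space \<Rightarrow> 'v::real_vector" and L :: "'v \<Rightarrow> 'w::real_vector"
  assumes g: "inner_product_on E g" and h: "inner_product_on F h"
    and i: "linear i" "inj i" "range i = E"
    and L: "linear (\<lambda>a. L (i a))" "\<And>a. L (i a) \<in> F"
    and b: "b \<ge> 0" "\<And>a. b\<^sup>2 * g (i a) (i a) \<le> h (L (i a)) (L (i a))"
  shows "b \<le> sigma_min E g F h L"
proof -
  have iE: "i a \<in> E" for a using i by auto
  \<comment> \<open>Both inner products are pulled back to the coordinate space \<open>'e\<close>:
    unlike \<open>E\<close>, it carries a topology, and its unit sphere is compact.\<close>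
  define G where "G a c = g (i a) (i c)" for a c
  define H where "H a c = h (L (i a)) (L (i c))" for a c
  have Gsym: "G a c = G c a" for a c
    using g iE by (auto simp: inner_product_on_def G_def)
  have Hsym: "H a c = H c a" for a c
    using h L by (auto simp: inner_product_on_def H_def)
  have hlin: "linear (\<lambda>a. h (L (i a)) w)" if "w \<in> F" for w
    using h L that by (intro linearI) (auto simp: inner_product_on_def linear_add[OF L(1)] linear_scale[OF L(1)])
  have "linear (\<lambda>a. G a c)" for c
    using g iE unfolding G_def
    by (intro linearI) (auto simp: inner_product_on_def linear_add[OF i(1)] linear_scale[OF i(1)])
  moreover have "G c = (\<lambda>a. G a c)" for c
    by (rule ext) (rule Gsym)
  ultimately have G: "bilinear G"
    unfolding bilinear_def by metis
  have "linear (\<lambda>a. H a c)" for c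
    using hlin L(2) by (simp add: H_def)
  moreover have "H c = (\<lambda>a. H a c)" for c
    by (rule ext) (rule Hsym)
  ultimately have H: "bilinear H"
    unfolding bilinear_def by metis
  have i0: "i a = 0 \<longleftrightarrow> a = 0" for a
    using i(1,2) by (metis linear_injective_0 linear_0)
  have Gpos: "G a a > 0" if "a \<noteq> 0" for a
    using g iE i0 that by (auto simp: inner_product_on_def G_def)
  have Hnn: "H a a \<ge> 0" for a
  proof (cases "L (i a) = 0")
    case True
    \<comment> \<open>\<open>inner_product_on\<close> asserts positivity only at nonzero vectors;
      the value at zero comes from homogeneity with factor 0.\<close>
    then have "H a a = h (0 *\<^sub>R L (i a)) (L (i a))" by (simp add: H_def)
    also have "\<dots> = 0 * h (L (i a)) (L (i a))"
      using h L(2)[of a] unfolding inner_product_on_def by blast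
    finally show ?thesis by simp
  next
    case False
    then show ?thesis
      using h L(2)[of a] by (auto simp: inner_product_on_def H_def less_imp_le)
  qed
  have "continuous_on S (\<lambda>a. G a a)" "continuous_on S (\<lambda>a. H a a)" for S
    by (intro bilinear_continuous_on_compose[where h = G] bilinear_continuous_on_compose[where h = H]
        continuous_on_id G H)+
  then have "continuous_on (sphere 0 1) (\<lambda>a. H a a / G a a)"
  proof (intro continuous_on_divide ballI)
    fix a :: 'e assume "a \<in> sphere 0 1"
    then have "a \<noteq> 0" by auto
    then show "G a a \<noteq> 0" using Gpos[of a] by simp
  qed
  then obtain m where m: "m \<in> sphere 0 1"
      and le: "\<And>a. a \<in> sphere 0 1 \<Longrightarrow> H m m / G m m \<le> H a a / G a a"
    using continuous_attains_inf[OF compact_sphere, of "0::'e" 1 "\<lambda>a. H a a / G a a"]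
    by (auto simp del: mem_sphere mem_sphere_0)
  define l where "l = H m m / G m m"
  have "m \<noteq> 0" using m by auto
  \<comment> \<open>By minimality of \<open>l\<close> this form is positive semidefinite, and it is
    null at the minimiser \<open>m\<close>, so \<open>psd_form_null\<close> applies.\<close>
  define P where "P a c = H a c - l * G a c" for a c
  have P: "bilinear P"
    unfolding P_def bilinear_def
    using G H by (auto intro!: linearI simp: bilinear_ladd bilinear_radd bilinear_lmul bilinear_rmul algebra_simps)
  have Pnn: "P a a \<ge> 0" for a
  proof (cases "a = 0")
    case True
    then show ?thesis using P by (simp add: bilinear_lzero)
  next
    case False
    define e where "e = a /\<^sub>R norm a"
    have "e \<in> sphere 0 1" "e \<noteq> 0" using False by (auto simp: e_def)
    with le[of e] Gpos[of e] have "P e e \<ge> 0"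
      by (simp add: P_def l_def[symmetric] pos_le_divide_eq)
    moreover have "P (norm a *\<^sub>R e) (norm a *\<^sub>R e) = (norm a)\<^sup>2 * P e e"
      using P by (simp add: bilinear_lmul bilinear_rmul power2_eq_square)
    moreover have "norm a *\<^sub>R e = a" using False by (simp add: e_def)
    ultimately show ?thesis by simp
  qed
  have Pmm: "P m m = 0" using Gpos[OF \<open>m \<noteq> 0\<close>] by (simp add: P_def l_def)
  have Pm: "P m a = 0" for a
  proof (rule psd_form_null[OF P _ Pnn Pmm])
    show "P u v = P v u" for u v
      using Gsym[of u v] Hsym[of u v] by (simp add: P_def)
  qed
  define L' where "L' = adjoint_on E g F h L"
  \<comment> \<open>\<open>adjoint_on\<close> is a \<open>SOME\<close>, so its defining property
    becomes available only once some adjoint is known to exist.\<close>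
  have "\<exists>u. u \<in> E \<and> (\<forall>v\<in>E. h (L v) w = g v u)" if w: "w \<in> F" for w
  proof -
    obtain z where "\<And>a. h (L (i a)) w = G a z"
      using riesz_positive_definite[OF G Gpos hlin[OF w]] by metis
    then show ?thesis
      using iE i(3) unfolding G_def by blast
  qed
  then have "\<exists>L'. \<forall>w\<in>F. L' w \<in> E \<and> (\<forall>v\<in>E. h (L v) w = g v (L' w))"
    by metis
  then have L': "\<forall>w\<in>F. L' w \<in> E \<and> (\<forall>v\<in>E. h (L v) w = g v (L' w))"
    unfolding L'_def adjoint_on_def by (rule someI_ex)
  have "l \<ge> 0" using Hnn Gpos[OF \<open>m \<noteq> 0\<close>] by (simp add: l_def)
  \<comment> \<open>\<open>P m\<close> vanishing identically says that \<open>L' (L (i m))\<close>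
    and \<open>l\<close> times \<open>i m\<close> have the same inner product with every vector of
    \<open>E\<close>; testing with their difference makes them equal.\<close>
  have "L' (L (i m)) = l *\<^sub>R i m"
  proof -
    obtain a' where a': "L' (L (i m)) = i a'"
      using L' L(2) i(3) by blast
    have "H a m = G a a'" for a
      using L' L(2) iE a' unfolding H_def G_def by metis
    then have "G a a' = l * G a m" for a
      using Pm[of a] Hsym[of m a] Gsym[of m a] by (simp add: P_def)
    then have "G (a' - l *\<^sub>R m) (a' - l *\<^sub>R m) = 0"
      using G by (simp add: bilinear_rsub bilinear_rmul)
    then have "a' = l *\<^sub>R m"
      using Gpos[of "a' - l *\<^sub>R m"] by fastforce
    then show ?thesis using a' i(1) by (simp add: linear_scale)
  qed
  then have "singular_value E g F h L (sqrt l)"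
    unfolding singular_value_def L'_def[symmetric] using \<open>l \<ge> 0\<close> \<open>m \<noteq> 0\<close> iE i0
    by (auto intro!: bexI[of _ "i m"])
  \<comment> \<open>An eigenvector with coordinate \<open>a\<close> has quotient
    \<open>H a a / G a a\<close> equal to the square of \<open>\<sigma>\<close>, and
    \<open>l\<close> is the minimum of that quotient.\<close>
  moreover have "sqrt l \<le> \<sigma>" if \<sigma>: "singular_value E g F h L \<sigma>" for \<sigma>
  proof -
    from \<sigma> obtain a where a: "\<sigma> \<ge> 0" "i a \<noteq> 0" "L' (L (i a)) = \<sigma>\<^sup>2 *\<^sub>R i a"
      unfolding singular_value_def L'_def[symmetric] using i(3) by blast
    have "H a a = g (i a) (i (\<sigma>\<^sup>2 *\<^sub>R a))"
      using L' L(2) iE a(3) i(1) unfolding H_def by (metis linear_scale)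
    also have "\<dots> = \<sigma>\<^sup>2 * G a a"
      using G unfolding G_def[symmetric] by (simp add: bilinear_rmul)
    finally have "l * G a a \<le> \<sigma>\<^sup>2 * G a a"
      using Pnn[of a] by (simp add: P_def)
    then have "l \<le> \<sigma>\<^sup>2" using Gpos[of a] a(2) i0 by simp
    then show ?thesis using a(1) by (simp add: real_le_lsqrt)
  qed
  ultimately have "sigma_min E g F h L = sqrt l"
    unfolding sigma_min_def by (rule Least_equality)
  moreover have "b\<^sup>2 \<le> l"
    using b(2)[of m] Gpos[OF \<open>m \<noteq> 0\<close>] by (simp add: l_def G_def H_def pos_le_divide_eq)
  ultimately show ?thesis
    using b(1) by (simp add: real_le_rsqrt)
qed

section \<open>The estimate in coordinates\<close>

text \<open>Expanding \<open>v\<close> in the standard basis writes \<open>M x v\<close> as a finite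
  sum of products of continuous functions. In finite dimension, continuity for each fixed vector
  thus becomes joint continuity.\<close>

lemma continuous_on_linear_family:
  fixes M :: "'x::topological_space \<Rightarrow> 'e::euclidean_space \<Rightarrow> 'f::real_normed_vector"
  assumes lin: "\<And>x. x \<in> S \<Longrightarrow> linear (M x)" and "\<And>v. continuous_on S (\<lambda>x. M x v)"
  shows "continuous_on (S \<times> UNIV) (\<lambda>p. M (fst p) (snd p))"
proof -
  have "continuous_on (S \<times> UNIV) (\<lambda>p. \<Sum>b\<in>Basis. (snd p \<bullet> b) *\<^sub>R M (fst p) b)"
    by (intro continuous_intros continuous_on_compose2[OF assms(2)]) auto
  moreover have "(\<Sum>b\<in>Basis. (v \<bullet> b) *\<^sub>R M x b) = M x v" if "x \<in> S" for x v
  proof -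
    have "(\<Sum>b\<in>Basis. (v \<bullet> b) *\<^sub>R M x b) = M x (\<Sum>b\<in>Basis. (v \<bullet> b) *\<^sub>R b)"
      using lin[OF that] by (simp add: linear_sum linear_scale)
    then show ?thesis by (simp add: euclidean_representation)
  qed
  ultimately show ?thesis
    by (subst continuous_on_cong[OF refl, where g = "\<lambda>p. \<Sum>b\<in>Basis. (snd p \<bullet> b) *\<^sub>R M (fst p) b"]) auto
qed

text \<open>The linear case is applied twice; the second time, the first vector argument has become
  part of the parameter.\<close>

lemma continuous_on_bilinear_family:
  fixes G :: "'x::topological_space \<Rightarrow> 'e::euclidean_space \<Rightarrow> 'e \<Rightarrow> 'f::real_normed_vector"
  assumes "\<And>x. x \<in> S \<Longrightarrow> bilinear (G x)" and "\<And>u v. continuous_on S (\<lambda>x. G x u v)"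
  shows "continuous_on (S \<times> UNIV \<times> UNIV) (\<lambda>(x, u, v). G x u v)"
proof -
  have "continuous_on (S \<times> UNIV) (\<lambda>p. G (fst p) (snd p) v)" for v
    using assms by (intro continuous_on_linear_family[where M = "\<lambda>x u. G x u v"]) (auto simp: bilinear_def)
  then have "continuous_on ((S \<times> UNIV) \<times> UNIV) (\<lambda>p. G (fst (fst p)) (snd (fst p)) (snd p))"
    using assms(1) by (intro continuous_on_linear_family[where M = "\<lambda>p v. G (fst p) (snd p) v"]) (auto simp: bilinear_def)
  then have "continuous_on (S \<times> UNIV \<times> UNIV)
      (\<lambda>q. (\<lambda>p. G (fst (fst p)) (snd (fst p)) (snd p)) ((fst q, fst (snd q)), snd (snd q)))"
    by (rule continuous_on_compose2) (auto intro!: continuous_intros)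
  then show ?thesis by (simp add: case_prod_unfold)
qed

text \<open>Tube lemma: the open set where \<open>f\<close> is positive contains the compact slice
  over \<open>x\<close>, hence a whole tube around it.\<close>

lemma locally_pos_on_sphere:
  fixes f :: "'x::euclidean_space \<times> 'e::euclidean_space \<Rightarrow> real"
  assumes "open S" and "x \<in> S" and "continuous_on (S \<times> UNIV) f"
    and "\<And>w. norm w = 1 \<Longrightarrow> f (x, w) > 0"
  obtains N where "open N" and "x \<in> N" and "N \<subseteq> S"
    and "\<And>y w. y \<in> N \<Longrightarrow> norm w = 1 \<Longrightarrow> f (y, w) > 0"
proof -
  define W where "W = (S \<times> UNIV) \<inter> f -` {0<..}"
  have "open W"
    unfolding W_def using assms by (intro continuous_open_preimage) (auto intro: open_Times)
  moreover have "{x} \<times> sphere 0 1 \<subseteq> W"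
    using assms by (auto simp: W_def)
  ultimately obtain X where "x \<in> X" "open X" "X \<times> sphere 0 1 \<subseteq> W"
    using Elementary_Topology.tube_lemma[of "sphere (0::'e) 1" W x] by (metis compact_sphere)
  then show thesis
    using that[of "X \<inter> S"] assms(1,2) by (force simp: W_def)
qed

text \<open>\<open>F\<close> stands for the retraction in a chart, \<open>M\<close> for its fibre
  derivative and \<open>G\<close> for the metric. The neighbourhood is shrunk twice: once to make
  the comparison of norms hold for \<open>(y, v)\<close> in a product neighbourhood, and once to
  make \<open>G y\<close> dominate a fixed multiple of the Euclidean norm, so that a bound on the
  Riemannian length of \<open>v\<close> forces \<open>v\<close> into that neighbourhood.\<close>

lemma local_coordinate_estimate:
  fixes F :: "'e::euclidean_space \<times> 'e \<Rightarrow> 'e" and G :: "'e \<Rightarrow> 'e \<Rightarrow> 'e \<Rightarrow> real"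
  assumes S: "open S" and W: "open W" and F: "continuous_on W F" "F ` W \<subseteq> S"
    and M: "\<And>p. p \<in> W \<Longrightarrow> linear (M p)" "\<And>v. continuous_on W (\<lambda>p. M p v)"
    and G: "\<And>y. y \<in> S \<Longrightarrow> bilinear (G y)" "\<And>u v. continuous_on S (\<lambda>y. G y u v)"
    and x: "x \<in> S" "(x, 0) \<in> W" "F (x, 0) = x" "\<And>w. M (x, 0) w = w"
    and pos: "\<And>w. w \<noteq> 0 \<Longrightarrow> G x w w > 0" and b: "0 < b" "b < 1"
  obtains N a where "open N" and "x \<in> N" and "N \<subseteq> S" and "a > 0"
    and "\<And>y v. y \<in> N \<Longrightarrow> G y v v \<le> a\<^sup>2 \<Longrightarrow>
      (y, v) \<in> W \<and> (\<forall>w. b\<^sup>2 * G y w w \<le> G (F (y, v)) (M (y, v) w) (M (y, v) w))"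
proof -
  note Gc = continuous_on_bilinear_family[OF G]
  note Mc = continuous_on_linear_family[OF M]
  \<comment> \<open>The metric is evaluated at \<open>F (y, v)\<close> and at the base point
    \<open>y\<close>; on \<open>W'\<close> both lie in \<open>S\<close>.\<close>
  define W' where "W' = W \<inter> S \<times> UNIV"
  have W': "open W'" unfolding W'_def using S W by (intro open_Int open_Times) auto
  have Gc1: "continuous_on (W' \<times> UNIV)
      (\<lambda>q. (\<lambda>(x, u, v). G x u v) (F (fst q), M (fst q) (snd q), M (fst q) (snd q)))"
  proof (rule continuous_on_compose2[OF Gc])
    have "continuous_on (W' \<times> UNIV) (\<lambda>q. M (fst q) (snd q))"
      using Mc by (rule continuous_on_subset) (auto simp: W'_def)
    moreover have "continuous_on (W' \<times> UNIV) (\<lambda>q. F (fst q))"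
      by (rule continuous_on_compose2[OF F(1)]) (auto simp: W'_def intro!: continuous_intros)
    ultimately show "continuous_on (W' \<times> UNIV) (\<lambda>q. (F (fst q), M (fst q) (snd q), M (fst q) (snd q)))"
      by (intro continuous_intros)
  qed (use F(2) in \<open>auto simp: W'_def\<close>)
  have Gc2: "continuous_on (W' \<times> UNIV) (\<lambda>q. (\<lambda>(x, u, v). G x u v) (fst (fst q), snd q, snd q))"
    by (rule continuous_on_compose2[OF Gc]) (auto simp: W'_def intro!: continuous_intros)
  define f where "f q = G (F (fst q)) (M (fst q) (snd q)) (M (fst q) (snd q))
      - b\<^sup>2 * G (fst (fst q)) (snd q) (snd q)" for q
  have fc: "continuous_on (W' \<times> UNIV) f"
    unfolding f_def using Gc1 Gc2 by (intro continuous_intros) auto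
  have "b\<^sup>2 < 1" using b by (simp add: power_less_one_iff)
  have f0: "f ((x, 0), w) > 0" if "norm w = 1" for w
  proof -
    have "w \<noteq> 0" using that by auto
    then have "b\<^sup>2 * G x w w < 1 * G x w w"
      using pos \<open>b\<^sup>2 < 1\<close> by (intro mult_strict_right_mono)
    then show ?thesis by (simp add: f_def x)
  qed
  obtain N1 where N1: "open N1" "(x, 0) \<in> N1" "N1 \<subseteq> W'"
    and f: "\<And>y w. y \<in> N1 \<Longrightarrow> norm w = 1 \<Longrightarrow> f (y, w) > 0"
    using locally_pos_on_sphere[OF W' _ fc f0] x by (auto simp: W'_def)
  obtain N2 D where N2: "open N2" "open D" "(x, 0) \<in> N2 \<times> D" "N2 \<times> D \<subseteq> N1"
    using N1 by (metis open_prod_elim)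
  obtain d where d: "d > 0" "ball 0 d \<subseteq> D"
    using N2 by (metis openE mem_Sigma_iff)
  have "continuous_on (sphere 0 1) (\<lambda>w. (\<lambda>(x, u, v). G x u v) (x, w, w))"
    by (rule continuous_on_compose2[OF Gc]) (use x in \<open>auto intro!: continuous_intros\<close>)
  then obtain w0 where w0: "w0 \<in> sphere 0 1" "\<And>w. w \<in> sphere 0 1 \<Longrightarrow> G x w0 w0 \<le> G x w w"
    using continuous_attains_inf[of "sphere (0::'e) 1" "\<lambda>w. G x w w"] by auto
  \<comment> \<open>Half the minimum of \<open>G x\<close> on the unit sphere:
    \<open>G x w w > k\<close> is then strict at \<open>x\<close>, and so persists at nearby base
    points.\<close>
  define k where "k = G x w0 w0 / 2"
  have "w0 \<noteq> 0" using w0 by auto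
  then have "k > 0" using pos by (simp add: k_def)
  have "continuous_on (S \<times> UNIV) (\<lambda>q. (\<lambda>(x, u, v). G x u v) (fst q, snd q, snd q))"
    by (rule continuous_on_compose2[OF Gc]) (auto intro!: continuous_intros)
  then have c3: "continuous_on (S \<times> UNIV) (\<lambda>q. G (fst q) (snd q) (snd q) - k)"
    by (intro continuous_intros) simp
  have k0: "G (fst (x, w)) (snd (x, w)) (snd (x, w)) - k > 0" if "norm w = 1" for w
    using w0(2)[of w] that \<open>k > 0\<close> by (simp add: k_def)
  obtain N3 where N3: "open N3" "x \<in> N3" "N3 \<subseteq> S"
      and k: "\<And>y w. y \<in> N3 \<Longrightarrow> norm w = 1 \<Longrightarrow> G y w w - k > 0"
    using locally_pos_on_sphere[OF S x(1) c3 k0] by auto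
  \<comment> \<open>Near \<open>x\<close>, \<open>G y v v\<close> is at least \<open>k\<close> times
    the squared Euclidean norm of \<open>v\<close>, so \<open>G y v v \<le> a\<^sup>2\<close> gives
    \<open>norm v \<le> d / 2\<close>. The factor 1/2 puts \<open>v\<close> strictly inside the open
    ball of radius \<open>d\<close>.\<close>
  define a where "a = sqrt k * d / 2"
  have quad: "B v v = (norm v)\<^sup>2 * B (v /\<^sub>R norm v) (v /\<^sub>R norm v)" if "bilinear B" "v \<noteq> 0"
      for B :: "'e \<Rightarrow> 'e \<Rightarrow> real" and v
    using that by (simp add: bilinear_lmul bilinear_rmul power2_eq_square field_simps)
  show thesis
  proof (rule that)
    show "open (N2 \<inter> N3)" "x \<in> N2 \<inter> N3" "N2 \<inter> N3 \<subseteq> S" using N2 N3 by auto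
    show "a > 0" using d \<open>k > 0\<close> by (simp add: a_def)
    fix y v assume y: "y \<in> N2 \<inter> N3" and v: "G y v v \<le> a\<^sup>2"
    have "y \<in> S" using y N3 by auto
    have "norm v < d"
    proof (cases "v = 0")
      case False
      then have "(norm v)\<^sup>2 * k \<le> (norm v)\<^sup>2 * G y (v /\<^sub>R norm v) (v /\<^sub>R norm v)"
        using k[of y "v /\<^sub>R norm v"] y by (intro mult_left_mono) auto
      also have "\<dots> \<le> a\<^sup>2"
        using quad[OF G(1)[OF \<open>y \<in> S\<close>] False] v by simp
      also have "\<dots> = k * (d / 2)\<^sup>2"
        using \<open>k > 0\<close> by (simp add: a_def power_mult_distrib power_divide)
      finally have "(norm v)\<^sup>2 \<le> (d / 2)\<^sup>2" using \<open>k > 0\<close> by (simp add: mult.commute)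
      then have "norm v \<le> d / 2" using d(1) by (simp add: power2_le_iff_abs_le)
      then show ?thesis using d(1) by simp
    qed (use d in simp)
    then have yv: "(y, v) \<in> N1" using y d N2 by auto
    then have "(y, v) \<in> W" using N1 by (auto simp: W'_def)
    then have FS: "F (y, v) \<in> S" using F by auto
    note lin = M(1)[OF \<open>(y, v) \<in> W\<close>]
    have "b\<^sup>2 * G y w w \<le> G (F (y, v)) (M (y, v) w) (M (y, v) w)" for w
    proof (cases "w = 0")
      case True
      then show ?thesis using lin G(1)[OF FS] G(1)[OF \<open>y \<in> S\<close>]
        by (simp add: linear_0 bilinear_lzero)
    next
      case False
      \<comment> \<open>Both sides are homogeneous of degree two in \<open>w\<close>, so positivity
        of \<open>f\<close> at the unit vector \<open>e\<close> suffices.\<close>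
      define e where "e = w /\<^sub>R norm w"
      have w: "w = norm w *\<^sub>R e" using False by (simp add: e_def)
      have "f ((y, v), e) > 0" using f[OF yv] False by (simp add: e_def)
      then have "(norm w)\<^sup>2 * (b\<^sup>2 * G y e e) \<le> (norm w)\<^sup>2 * G (F (y, v)) (M (y, v) e) (M (y, v) e)"
        by (intro mult_left_mono) (auto simp: f_def)
      moreover have "G y w w = (norm w)\<^sup>2 * G y e e"
        using quad[OF G(1)[OF \<open>y \<in> S\<close>] False] by (simp add: e_def)
      moreover have "M (y, v) w = norm w *\<^sub>R M (y, v) e"
        using w lin by (metis linear_scale)
      then have "G (F (y, v)) (M (y, v) w) (M (y, v) w) = (norm w)\<^sup>2 * G (F (y, v)) (M (y, v) e) (M (y, v) e)"
        using G(1)[OF FS] by (simp add: bilinear_lmul bilinear_rmul power2_eq_square)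
      ultimately show ?thesis by (simp add: mult_ac)
    qed
    with \<open>(y, v) \<in> W\<close> show "(y, v) \<in> W \<and> (\<forall>w. b\<^sup>2 * G y w w \<le> G (F (y, v)) (M (y, v) w) (M (y, v) w))"
      by blast
  qed
qed

section \<open>Tangent vectors and metrics in charts\<close>

lemma smooth_on_differentiable: "smooth_on S f \<Longrightarrow> x \<in> S \<Longrightarrow> f differentiable (at x)"
  unfolding smooth_on_def by (metis Ck_on.simps(2))

lemma smooth_on_has_derivative:
  "smooth_on S f \<Longrightarrow> x \<in> S \<Longrightarrow> (f has_derivative frechet_derivative f (at x)) (at x)"
  using smooth_on_differentiable frechet_derivative_works by blast

lemma smooth_on_continuous_on: "smooth_on S f \<Longrightarrow> continuous_on S f"
  unfolding smooth_on_def by (metis Ck_on.simps(1))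

lemma smooth_on_continuous_on_derivative:
  "smooth_on S f \<Longrightarrow> continuous_on S (\<lambda>x. frechet_derivative f (at x) v)"
  unfolding smooth_on_def by (metis Ck_on.simps)

locale smooth_structure =
  fixes A :: "('a, 'e::euclidean_space) atlas"
  assumes smooth_atlas: "smooth_atlas A"
begin

lemma is_chart: "c \<in> A \<Longrightarrow> is_chart c"
  using smooth_atlas by (auto simp: smooth_atlas_def)

lemma chart_inj: "c \<in> A \<Longrightarrow> inj_on (chart_coord c) (chart_dom c)"
  using is_chart by (auto simp: is_chart_def)

lemma param_coord [simp]: "c \<in> A \<Longrightarrow> x \<in> chart_dom c \<Longrightarrow> param c (chart_coord c x) = x"
  using chart_inj by (simp add: param_def)

lemma coord_param [simp]: "y \<in> chart_coord c ` chart_dom c \<Longrightarrow> chart_coord c (param c y) = y"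
  by (simp add: param_def f_inv_into_f)

lemma param_in_dom [simp]: "y \<in> chart_coord c ` chart_dom c \<Longrightarrow> param c y \<in> chart_dom c"
  by (simp add: param_def inv_into_into)

lemma open_overlap: "c \<in> A \<Longrightarrow> d \<in> A \<Longrightarrow> open (chart_coord c ` (chart_dom c \<inter> chart_dom d))"
  using smooth_atlas by (auto simp: smooth_atlas_def compatible_def)

lemma smooth_transition:
  "c \<in> A \<Longrightarrow> d \<in> A \<Longrightarrow> smooth_on (chart_coord c ` (chart_dom c \<inter> chart_dom d)) (transition c d)"
  using smooth_atlas by (auto simp: smooth_atlas_def compatible_def)

lemma transition_coord [simp]:
  "c \<in> A \<Longrightarrow> x \<in> chart_dom c \<Longrightarrow> transition c d (chart_coord c x) = chart_coord d x"
  by (simp add: transition_def)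

lemma transition_has_derivative:
  assumes "c \<in> A" "d \<in> A" "x \<in> chart_dom c" "x \<in> chart_dom d"
  shows "(transition c d has_derivative frechet_derivative (transition c d) (at (chart_coord c x)))
    (at (chart_coord c x))"
  by (rule smooth_on_has_derivative[OF smooth_transition]) (use assms in auto)

text \<open>The cocycle identity for derivatives, by the chain rule:
  \<open>transition d e \<circ> transition c d\<close> agrees with \<open>transition c e\<close> on
  the coordinate image of the overlap of \<open>c\<close> and \<open>d\<close>, which is
  open.\<close>

lemma transition_derivative_trans:
  assumes c: "c \<in> A" "x \<in> chart_dom c" and d: "d \<in> A" "x \<in> chart_dom d"
    and e: "e \<in> A" "x \<in> chart_dom e"
  shows "frechet_derivative (transition c e) (at (chart_coord c x)) a =
    frechet_derivative (transition d e) (at (chart_coord d x))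
      (frechet_derivative (transition c d) (at (chart_coord c x)) a)"
proof -
  let ?D = "\<lambda>c d. frechet_derivative (transition c d) (at (chart_coord c x))"
  have "(transition d e \<circ> transition c d has_derivative ?D d e \<circ> ?D c d) (at (chart_coord c x))"
    by (rule diff_chain_at) (use assms transition_has_derivative in auto)
  then have "(transition c e has_derivative ?D d e \<circ> ?D c d) (at (chart_coord c x))"
    by (rule has_derivative_transform_within_open[OF _ open_overlap[OF c(1) d(1)]]) (use assms in auto)
  then show ?thesis
    using frechet_derivative_at by (metis comp_apply)
qed

lemma transition_derivative_self:
  assumes "c \<in> A" "x \<in> chart_dom c"
  shows "frechet_derivative (transition c c) (at (chart_coord c x)) a = a"
proof -
  have "((\<lambda>y. y) has_derivative (\<lambda>y. y)) (at (chart_coord c x))"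
    by (rule has_derivative_ident)
  then have "(transition c c has_derivative (\<lambda>y. y)) (at (chart_coord c x))"
    by (rule has_derivative_transform_within_open[OF _ open_overlap[OF assms(1,1)]]) (use assms in auto)
  then show ?thesis
    using frechet_derivative_at by metis
qed

lemma chart_vector_self [simp]: "c \<in> A \<Longrightarrow> x \<in> chart_dom c \<Longrightarrow> chart_vector A c x a c = a"
  by (simp add: chart_vector_def transition_derivative_self)

text \<open>The compatibility required of a tangent vector between two further charts is exactly the
  cocycle identity.\<close>

lemma chart_vector_in [simp]:
  assumes "c \<in> A" "x \<in> chart_dom c"
  shows "chart_vector A c x a \<in> tangent_space A x"
proof -
  have "chart_vector A c x a e = frechet_derivative (transition d e) (at (chart_coord d x)) (chart_vector A c x a d)"
    if "d \<in> A" "e \<in> A" "x \<in> chart_dom d" "x \<in> chart_dom e" for d e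
    using transition_derivative_trans[OF assms that(1,3,2,4), of a] that by (simp add: chart_vector_def)
  moreover have "chart_vector A c x a d = 0" if "\<not> (d \<in> A \<and> x \<in> chart_dom d)" for d
    using that by (auto simp: chart_vector_def)
  ultimately show ?thesis
    unfolding tangent_space_def by blast
qed

lemma chart_vector_coord:
  assumes "c \<in> A" "x \<in> chart_dom c" "v \<in> tangent_space A x"
  shows "chart_vector A c x (v c) = v"
proof
  fix d
  show "chart_vector A c x (v c) d = v d"
  proof (cases "d \<in> A \<and> x \<in> chart_dom d")
    case True
    then have "v d = frechet_derivative (transition c d) (at (chart_coord c x)) (v c)"
      using assms unfolding tangent_space_def by blast
    with True show ?thesis by (simp add: chart_vector_def)
  next
    case False
    then have "v d = 0" using assms(3) unfolding tangent_space_def by blast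
    with False show ?thesis by (auto simp: chart_vector_def)
  qed
qed

lemma linear_chart_vector:
  assumes "c \<in> A" "x \<in> chart_dom c"
  shows "linear (chart_vector A c x)"
proof -
  have "linear (frechet_derivative (transition c d) (at (chart_coord c x)))" if "d \<in> A" "x \<in> chart_dom d" for d
    using transition_has_derivative[OF assms(1) that(1) assms(2) that(2)] has_derivative_linear by blast
  then show ?thesis
    by (intro linearI ext) (auto simp: chart_vector_def scaleR_fun_def linear_add linear_scale)
qed

lemma inj_chart_vector: "c \<in> A \<Longrightarrow> x \<in> chart_dom c \<Longrightarrow> inj (chart_vector A c x)"
  by (rule injI) (metis chart_vector_self)

text \<open>With linearity and injectivity, this makes \<open>chart_vector A c x\<close> an
  isomorphism from \<open>'e\<close> onto the tangent space, the parametrisation \<open>i\<close>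
  that \<open>sigma_min_ge\<close> asks for.\<close>

lemma range_chart_vector: "c \<in> A \<Longrightarrow> x \<in> chart_dom c \<Longrightarrow> range (chart_vector A c x) = tangent_space A x"
proof (intro subset_antisym subsetI)
  assume c: "c \<in> A" "x \<in> chart_dom c"
  fix v
  show "v \<in> range (chart_vector A c x) \<Longrightarrow> v \<in> tangent_space A x"
    using chart_vector_in[OF c] by blast
  assume "v \<in> tangent_space A x"
  then show "v \<in> range (chart_vector A c x)"
    using chart_vector_coord[OF c, symmetric] by blast
qed

section \<open>Charts of the tangent bundle\<close>

lemma chart_dom_bundle [simp]: "chart_dom (bundle_chart A c) = (SIGMA x:chart_dom c. tangent_space A x)"
  and coord_bundle [simp]: "chart_coord (bundle_chart A c) (x, v) = (chart_coord c x, v c)"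
  by (simp_all add: bundle_chart_def)

text \<open>Over a common base point, a tangent vector is recovered from its entry at
  \<open>c\<close> by \<open>chart_vector_coord\<close>.\<close>

lemma inj_bundle:
  assumes "c \<in> A"
  shows "inj_on (chart_coord (bundle_chart A c)) (chart_dom (bundle_chart A c))"
proof (rule inj_onI)
  fix p q
  assume *: "p \<in> chart_dom (bundle_chart A c)" "q \<in> chart_dom (bundle_chart A c)"
    "chart_coord (bundle_chart A c) p = chart_coord (bundle_chart A c) q"
  obtain x v y w where p: "p = (x, v)" and q: "q = (y, w)" by fastforce
  have "x = y" using * chart_inj[OF assms] by (auto simp: p q dest: inj_onD)
  moreover have "v = w"
  proof -
    have "v = chart_vector A c x (v c)"
      by (rule chart_vector_coord[symmetric]) (use * assms in \<open>auto simp: p\<close>)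
    also have "\<dots> = chart_vector A c y (w c)"
      using * \<open>x = y\<close> by (simp add: p q)
    also have "\<dots> = w"
      by (rule chart_vector_coord) (use * assms in \<open>auto simp: q\<close>)
    finally show ?thesis .
  qed
  ultimately show "p = q" by (simp add: p q)
qed

lemma bundle_coord_image:
  assumes "c \<in> A"
  shows "chart_coord (bundle_chart A c) ` chart_dom (bundle_chart A c) = chart_coord c ` chart_dom c \<times> UNIV"
proof -
  have "(chart_coord c x, a) \<in> chart_coord (bundle_chart A c) ` chart_dom (bundle_chart A c)"
    if "x \<in> chart_dom c" for x a
  proof (rule image_eqI)
    show "(chart_coord c x, a) = chart_coord (bundle_chart A c) (x, chart_vector A c x a)"
      using assms that by (simp only: coord_bundle chart_vector_self)
    show "(x, chart_vector A c x a) \<in> chart_dom (bundle_chart A c)"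
      using assms that by (simp only: chart_dom_bundle mem_Sigma_iff chart_vector_in simp_thms)
  qed
  then have "chart_coord c ` chart_dom c \<times> UNIV \<subseteq> chart_coord (bundle_chart A c) ` chart_dom (bundle_chart A c)"
    by blast
  moreover have "chart_coord (bundle_chart A c) ` chart_dom (bundle_chart A c) \<subseteq> chart_coord c ` chart_dom c \<times> UNIV"
    by auto
  ultimately show ?thesis by blast
qed

lemma is_chart_bundle:
  assumes "c \<in> A"
  shows "is_chart (bundle_chart A c)"
  using is_chart[OF assms] inj_bundle[OF assms]
  unfolding is_chart_def bundle_coord_image[OF assms] by (simp add: open_Times)

lemma param_bundle:
  assumes "c \<in> A" "y \<in> chart_coord c ` chart_dom c"
  shows "param (bundle_chart A c) (y, a) = (param c y, chart_vector A c (param c y) a)"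
  unfolding param_def[of "bundle_chart A c"]
  by (rule inv_into_f_eq[OF inj_bundle]) (use assms in auto)

section \<open>The atlas topology, and the metric in a chart\<close>

lemma openin_atlas:
  "openin (atlas_topology A) W \<longleftrightarrow>
    W \<subseteq> points A \<and> (\<forall>c\<in>A. open (chart_coord c ` (W \<inter> chart_dom c)))"
  by (rule openin_atlas_topology) (rule is_chart)

text \<open>Seen in another chart \<open>d\<close>, the set is the preimage of \<open>N\<close>
  under the continuous map \<open>transition d c\<close> on the open overlap.\<close>

lemma openin_chart_preimage:
  assumes c: "c \<in> A" and N: "open N"
  shows "openin (atlas_topology A) {x \<in> chart_dom c. chart_coord c x \<in> N}"
proof -
  have "open (chart_coord d ` ({x \<in> chart_dom c. chart_coord c x \<in> N} \<inter> chart_dom d))" if d: "d \<in> A" for d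
  proof -
    have "chart_coord d ` ({x \<in> chart_dom c. chart_coord c x \<in> N} \<inter> chart_dom d)
        = chart_coord d ` (chart_dom d \<inter> chart_dom c) \<inter> transition d c -` N"
      using d by auto
    then show ?thesis
      using continuous_open_preimage[OF smooth_on_continuous_on[OF smooth_transition] open_overlap N] c d
      by auto
  qed
  then show ?thesis
    using c by (auto simp: openin_atlas points_def)
qed

lemma topspace_atlas: "topspace (atlas_topology A) = points A"
proof
  show "topspace (atlas_topology A) \<subseteq> points A"
    using openin_topspace[of "atlas_topology A"] unfolding openin_atlas by blast
  have "openin (atlas_topology A) (chart_dom c)" if "c \<in> A" for c
    using openin_chart_preimage[OF that open_UNIV] by simp
  then show "points A \<subseteq> topspace (atlas_topology A)"
    unfolding points_def by (auto dest: openin_subset)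
qed

lemma bilinear_chart_metric:
  assumes "riemannian_metric A g" "c \<in> A" "x \<in> chart_dom c"
  shows "bilinear (\<lambda>a b. g x (chart_vector A c x a) (chart_vector A c x b))"
proof -
  have "x \<in> points A" using assms by (auto simp: points_def)
  with assms have g: "inner_product_on (tangent_space A x) (g x)"
    by (simp add: riemannian_metric_def)
  have "linear (\<lambda>a. g x (chart_vector A c x a) (chart_vector A c x b))" for b
    using g assms linear_chart_vector[OF assms(2,3)]
    by (intro linearI) (simp_all add: inner_product_on_def linear_add linear_scale)
  \<comment> \<open>\<open>inner_product_on\<close> states linearity in the first argument; symmetry
    carries it over to the second.\<close>
  moreover have "(\<lambda>b. g x (chart_vector A c x a) (chart_vector A c x b))
      = (\<lambda>b. g x (chart_vector A c x b) (chart_vector A c x a))" for a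
    using g assms by (auto simp: inner_product_on_def)
  ultimately show ?thesis by (simp add: bilinear_def)
qed

end

section \<open>Retractions in charts\<close>

locale retraction_atlas = smooth_structure A
  for A :: "('a, 'e::euclidean_space) atlas" +
  fixes R :: "'a \<times> ('a, 'e) tangent \<Rightarrow> 'a"
  assumes retraction: "manifold_retraction A R"
begin

text \<open>Spelled as the composite in \<open>smooth_map\<close>, with \<open>coord_dom\<close> as
  its domain, so that smoothness can be read off from the retraction.\<close>

definition coord_R :: "('a, 'e) chart \<Rightarrow> ('a, 'e) chart \<Rightarrow> 'e \<times> 'e \<Rightarrow> 'e"
  where "coord_R c d = chart_coord d \<circ> R \<circ> param (bundle_chart A c)"

definition coord_dom :: "('a, 'e) chart \<Rightarrow> ('a, 'e) chart \<Rightarrow> ('e \<times> 'e) set"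
  where "coord_dom c d = chart_coord (bundle_chart A c) ` (chart_dom (bundle_chart A c) \<inter> R -` chart_dom d)"

lemma smooth_coord_R: "c \<in> A \<Longrightarrow> d \<in> A \<Longrightarrow> smooth_on (coord_dom c d) (coord_R c d)"
  using retraction by (auto simp: manifold_retraction_def smooth_map_def tangent_bundle_def coord_R_def coord_dom_def)

lemma in_coord_dom:
  assumes "c \<in> A" "y \<in> chart_coord c ` chart_dom c"
  shows "(y, a) \<in> coord_dom c d \<longleftrightarrow> R (param c y, chart_vector A c (param c y) a) \<in> chart_dom d"
proof
  assume "(y, a) \<in> coord_dom c d"
  then obtain x v where *: "x \<in> chart_dom c" "v \<in> tangent_space A x" "R (x, v) \<in> chart_dom d"
    "y = chart_coord c x" "a = v c"
    by (auto simp: coord_dom_def)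
  then show "R (param c y, chart_vector A c (param c y) a) \<in> chart_dom d"
    using assms by (simp add: chart_vector_coord)
next
  assume "R (param c y, chart_vector A c (param c y) a) \<in> chart_dom d"
  then show "(y, a) \<in> coord_dom c d"
    unfolding coord_dom_def using assms
    by (intro image_eqI[of _ _ "(param c y, chart_vector A c (param c y) a)"]) auto
qed

lemma coord_dom_subset: "c \<in> A \<Longrightarrow> coord_dom c d \<subseteq> chart_coord c ` chart_dom c \<times> UNIV"
  by (auto simp: coord_dom_def)

text \<open>Continuity of \<open>R\<close> makes the preimage of \<open>chart_dom d\<close> open in
  the tangent bundle, and open sets of an atlas topology have open chart images.\<close>

lemma open_coord_dom:
  assumes c: "c \<in> A" and d: "d \<in> A"
  shows "open (coord_dom c d)"
proof -
  let ?T = "atlas_topology (tangent_bundle A)"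
  let ?W = "{p \<in> topspace ?T. R p \<in> chart_dom d}"
  have tangent_charts: "\<And>c. c \<in> tangent_bundle A \<Longrightarrow> is_chart c"
    by (auto simp: tangent_bundle_def is_chart_bundle)
  have openin_T: "openin ?T W \<longleftrightarrow> W \<subseteq> points (tangent_bundle A) \<and>
      (\<forall>c\<in>tangent_bundle A. open (chart_coord c ` (W \<inter> chart_dom c)))" for W
    by (rule openin_atlas_topology) (rule tangent_charts)
  have "openin (atlas_topology A) (chart_dom d)"
    using openin_chart_preimage[OF d open_UNIV] by simp
  then have W: "openin ?T ?W"
    using retraction by (auto simp: manifold_retraction_def smooth_map_def intro: openin_continuous_map_preimage)
  then have "open (chart_coord (bundle_chart A c) ` (?W \<inter> chart_dom (bundle_chart A c)))"
    using c unfolding openin_T by (auto simp: tangent_bundle_def)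
  \<comment> \<open>Intersecting with the topological space then loses no point of the chart domain,
    so the open image is that of \<open>coord_dom\<close>.\<close>
  moreover have "chart_dom (bundle_chart A c) \<subseteq> topspace ?T"
  proof -
    have "openin ?T (points (tangent_bundle A))"
      unfolding openin_T
    proof (intro conjI ballI)
      fix k assume k: "k \<in> tangent_bundle A"
      then have "points (tangent_bundle A) \<inter> chart_dom k = chart_dom k" by (auto simp: points_def)
      then show "open (chart_coord k ` (points (tangent_bundle A) \<inter> chart_dom k))"
        using tangent_charts[OF k] by (simp add: is_chart_def)
    qed simp
    then have "points (tangent_bundle A) \<subseteq> topspace ?T" by (rule openin_subset)
    moreover have "chart_dom (bundle_chart A c) \<subseteq> points (tangent_bundle A)"
      using c unfolding points_def tangent_bundle_def by blast
    ultimately show ?thesis by blast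
  qed
  then have "?W \<inter> chart_dom (bundle_chart A c) = chart_dom (bundle_chart A c) \<inter> R -` chart_dom d"
    by blast
  ultimately show ?thesis by (simp add: coord_dom_def)
qed

lemma coord_R_eq:
  assumes "c \<in> A" "y \<in> chart_coord c ` chart_dom c"
  shows "coord_R c d (y, a) = chart_coord d (R (param c y, chart_vector A c (param c y) a))"
  using assms by (simp add: coord_R_def param_bundle)

text \<open>The derivative in the fibre direction only, since \<open>D R\<^sub>x(s)\<close> fixes the base point.\<close>

definition coord_DR :: "('a, 'e) chart \<Rightarrow> ('a, 'e) chart \<Rightarrow> 'e \<times> 'e \<Rightarrow> 'e \<Rightarrow> 'e"
  where "coord_DR c d p w = frechet_derivative (coord_R c d) (at p) (0, w)"

lemma coord_R_has_derivative:
  "c \<in> A \<Longrightarrow> d \<in> A \<Longrightarrow> p \<in> coord_dom c d \<Longrightarrow>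
    (coord_R c d has_derivative frechet_derivative (coord_R c d) (at p)) (at p)"
  by (rule smooth_on_has_derivative[OF smooth_coord_R])

lemma linear_coord_DR:
  assumes "c \<in> A" "d \<in> A" "p \<in> coord_dom c d"
  shows "linear (coord_DR c d p)"
proof -
  have "linear (frechet_derivative (coord_R c d) (at p))"
    using coord_R_has_derivative[OF assms] has_derivative_linear by blast
  moreover have "linear (\<lambda>w::'e. (0::'e, w))" by (intro linearI) auto
  ultimately show ?thesis
    unfolding coord_DR_def using linear_compose unfolding comp_def by blast
qed

lemma continuous_on_coord_DR:
  "c \<in> A \<Longrightarrow> d \<in> A \<Longrightarrow> continuous_on (coord_dom c d) (\<lambda>p. coord_DR c d p w)"
  unfolding coord_DR_def by (rule smooth_on_continuous_on_derivative[OF smooth_coord_R])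

text \<open>Chain rule for a change of the target chart from \<open>d\<close> to \<open>e\<close>.
  It is what makes the entries of the differential in different charts fit together as one tangent
  vector.\<close>

lemma coord_DR_change:
  assumes c: "c \<in> A" "x \<in> chart_dom c" and d: "d \<in> A" and e: "e \<in> A"
    and R: "R (x, chart_vector A c x a) \<in> chart_dom d" "R (x, chart_vector A c x a) \<in> chart_dom e"
  shows "coord_DR c e (chart_coord c x, a) w =
    frechet_derivative (transition d e) (at (chart_coord d (R (x, chart_vector A c x a))))
      (coord_DR c d (chart_coord c x, a) w)"
proof -
  let ?p = "(chart_coord c x, a)" and ?z = "R (x, chart_vector A c x a)"
  let ?D = "frechet_derivative (transition d e) (at (chart_coord d ?z))"
  have p: "?p \<in> coord_dom c d" "?p \<in> coord_dom c e"
    using c R by (simp_all add: in_coord_dom)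
  have z: "coord_R c d ?p = chart_coord d ?z"
    using c by (simp add: coord_R_eq)
  have "(transition d e \<circ> coord_R c d has_derivative ?D \<circ> frechet_derivative (coord_R c d) (at ?p)) (at ?p)"
    by (rule diff_chain_at) (use coord_R_has_derivative[OF c(1) d p(1)] transition_has_derivative[OF d e R] z in auto)
  then have "(coord_R c e has_derivative ?D \<circ> frechet_derivative (coord_R c d) (at ?p)) (at ?p)"
  proof (rule has_derivative_transform_within_open)
    show "open (coord_dom c d)" using c d by (simp add: open_coord_dom)
    show "?p \<in> coord_dom c d" by (rule p)
    fix q assume q: "q \<in> coord_dom c d"
    obtain y b where yb: "q = (y, b)" by fastforce
    with q have "y \<in> chart_coord c ` chart_dom c" using coord_dom_subset[OF c(1)] by blast
    then show "(transition d e \<circ> coord_R c d) q = coord_R c e q"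
      using q c d by (simp add: yb coord_R_eq in_coord_dom)
  qed
  then show ?thesis
    unfolding coord_DR_def using frechet_derivative_at by (metis comp_apply)
qed

text \<open>In the bundle chart of \<open>c\<close>, the curve defining the differential is the
  straight line with fixed base coordinate and fibre coordinate \<open>a + t w\<close>. Its image
  under \<open>coord_R c e\<close> has velocity \<open>coord_DR c e\<close>, and
  \<open>coord_DR_change\<close> relates this to \<open>d\<close>.\<close>

lemma retraction_diff_coord:
  assumes c: "c \<in> A" "x \<in> chart_dom c" and d: "d \<in> A" and R: "R (x, chart_vector A c x a) \<in> chart_dom d"
  shows "retraction_diff A R x (chart_vector A c x a) (chart_vector A c x w)
    = chart_vector A d (R (x, chart_vector A c x a)) (coord_DR c d (chart_coord c x, a) w)"
proof
  fix e
  let ?p = "(chart_coord c x, a)" and ?z = "R (x, chart_vector A c x a)"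
  have curve: "chart_vector A c x a + t *\<^sub>R chart_vector A c x w = chart_vector A c x (a + t *\<^sub>R w)" for t
    using linear_chart_vector[OF c] by (simp add: linear_add linear_scale)
  have "vector_derivative (\<lambda>t. chart_coord e (R (x, chart_vector A c x (a + t *\<^sub>R w)))) (at 0)
      = coord_DR c e ?p w" if e: "e \<in> A" "?z \<in> chart_dom e"
  proof -
    let ?D = "frechet_derivative (coord_R c e) (at ?p)"
    have "?p \<in> coord_dom c e" using c e by (simp add: in_coord_dom)
    then have D: "(coord_R c e has_derivative ?D) (at ?p)"
      using coord_R_has_derivative c e by blast
    have line: "((\<lambda>t. (chart_coord c x, a + t *\<^sub>R w)) has_derivative (\<lambda>t. (0, t *\<^sub>R w))) (at 0)"
      by (auto intro!: derivative_eq_intros)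
    have "((coord_R c e \<circ> (\<lambda>t. (chart_coord c x, a + t *\<^sub>R w))) has_derivative ?D \<circ> (\<lambda>t. (0, t *\<^sub>R w))) (at 0)"
      by (rule diff_chain_at[OF line]) (use D in simp)
    moreover have "?D \<circ> (\<lambda>t. (0, t *\<^sub>R w)) = (\<lambda>t. t *\<^sub>R ?D (0, w))"
    proof
      fix t
      have "?D (t *\<^sub>R (0, w)) = t *\<^sub>R ?D (0, w)"
        using D has_derivative_linear linear_scale by blast
      then show "(?D \<circ> (\<lambda>t. (0, t *\<^sub>R w))) t = t *\<^sub>R ?D (0, w)" by simp
    qed
    ultimately have "((\<lambda>t. coord_R c e (chart_coord c x, a + t *\<^sub>R w)) has_vector_derivative ?D (0, w)) (at 0)"
      by (simp add: has_vector_derivative_def comp_def)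
    then show ?thesis
      using c by (simp add: coord_R_eq coord_DR_def vector_derivative_at)
  qed
  \<comment> \<open>At charts outside \<open>A\<close>, or not containing the image point, both
    sides have the default entry 0.\<close>
  then show "retraction_diff A R x (chart_vector A c x a) (chart_vector A c x w) e
    = chart_vector A d ?z (coord_DR c d ?p w) e"
    using coord_DR_change[OF c d _ R]
    by (simp add: retraction_diff_def velocity_def curve chart_vector_def[of A d] comp_def)
qed

text \<open>One chart \<open>c\<close> around \<open>x\<close> serves for source and target:
  \<open>R\<close> fixes \<open>x\<close> at the zero vector, so short vectors at nearby points are
  still mapped into \<open>c\<close>.\<close>

lemma local_bound:
  fixes g :: "('a, 'e) metric"
  assumes g: "riemannian_metric A g" and x: "x \<in> points A" and b: "0 < b" "b < 1"
  obtains V a where "openin (atlas_topology A) V" and "x \<in> V" and "a > 0"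
    and "\<And>y s. y \<in> V \<Longrightarrow> s \<in> tangent_space A y \<Longrightarrow> riemannian_norm g y s \<le> a \<Longrightarrow>
      b \<le> sigma_min_diff A g R y s"
proof -
  obtain c where c: "c \<in> A" "x \<in> chart_dom c"
    using x by (auto simp: points_def)
  let ?S = "chart_coord c ` chart_dom c" and ?v = "\<lambda>y. chart_vector A c (param c y)"
  define G where "G y u v = g (param c y) (?v y u) (?v y v)" for y u v
  have R0: "R (x, chart_vector A c x 0) = x"
    using retraction x linear_0[OF linear_chart_vector[OF c]] by (simp add: manifold_retraction_def)
  \<comment> \<open>The identity differential at the zero vector, brought to coordinates by
    injectivity of \<open>chart_vector\<close>.\<close>
  have DR0: "coord_DR c c (chart_coord c x, 0) w = w" for w
  proof -
    have "retraction_diff A R x 0 (chart_vector A c x w) = chart_vector A c x w"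
      using retraction x chart_vector_in[OF c] by (simp add: manifold_retraction_def)
    then have "chart_vector A c x (coord_DR c c (chart_coord c x, 0) w) = chart_vector A c x w"
      using retraction_diff_coord[OF c c(1), of 0 w] R0 c linear_0[OF linear_chart_vector[OF c]] by simp
    then show ?thesis
      using inj_chart_vector[OF c] by (simp add: inj_eq)
  qed
  obtain N a where N: "open N" "chart_coord c x \<in> N" "N \<subseteq> ?S" and a: "a > 0"
    and est: "\<And>y v. y \<in> N \<Longrightarrow> G y v v \<le> a\<^sup>2 \<Longrightarrow> (y, v) \<in> coord_dom c c \<and>
      (\<forall>w. b\<^sup>2 * G y w w \<le> G (coord_R c c (y, v)) (coord_DR c c (y, v) w) (coord_DR c c (y, v) w))"
  proof (rule local_coordinate_estimate[of ?S "coord_dom c c" "coord_R c c" "coord_DR c c" G "chart_coord c x" b])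
    show "open ?S" using is_chart[OF c(1)] by (simp add: is_chart_def)
    show "open (coord_dom c c)" using c by (simp add: open_coord_dom)
    show "continuous_on (coord_dom c c) (coord_R c c)"
      using c smooth_coord_R smooth_on_continuous_on by blast
    show "coord_R c c ` coord_dom c c \<subseteq> ?S"
    proof (clarify, goal_cases)
      case (1 p y v)
      then have "y \<in> ?S" using coord_dom_subset[OF c(1)] by blast
      with 1 show ?case using c by (simp add: coord_R_eq in_coord_dom)
    qed
    show "linear (coord_DR c c p)" if "p \<in> coord_dom c c" for p
      using linear_coord_DR c that by blast
    show "continuous_on (coord_dom c c) (\<lambda>p. coord_DR c c p v)" for v
      using continuous_on_coord_DR c by blast
    show "bilinear (G y)" if "y \<in> ?S" for y
      using bilinear_chart_metric[OF g c(1), of "param c y"] that by (simp add: G_def[abs_def])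
    show "continuous_on ?S (\<lambda>y. G y u v)" for u v
      using g c unfolding G_def riemannian_metric_def by (blast intro: smooth_on_continuous_on)
    show "chart_coord c x \<in> ?S" using c by blast
    show "(chart_coord c x, 0) \<in> coord_dom c c"
      using c R0 by (simp add: in_coord_dom)
    show "coord_R c c (chart_coord c x, 0) = chart_coord c x"
      using c R0 by (simp add: coord_R_eq)
    show "coord_DR c c (chart_coord c x, 0) w = w" for w
      by (rule DR0)
    show "G (chart_coord c x) w w > 0" if "w \<noteq> 0" for w
    proof -
      have "chart_vector A c x w \<noteq> 0"
        using that c by (metis chart_vector_self zero_fun_apply)
      then show ?thesis
        using g x c chart_vector_in[OF c] by (simp add: G_def riemannian_metric_def inner_product_on_def)
    qed
  qed (use b in auto)
  show thesis
  proof (rule that)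
    show "openin (atlas_topology A) {y \<in> chart_dom c. chart_coord c y \<in> N}"
      using openin_chart_preimage c N by blast
    show "x \<in> {y \<in> chart_dom c. chart_coord c y \<in> N}" "a > 0"
      using c N a by auto
    fix y s
    assume "y \<in> {y \<in> chart_dom c. chart_coord c y \<in> N}" and s: "s \<in> tangent_space A y"
      and norm: "riemannian_norm g y s \<le> a"
    then have y: "y \<in> chart_dom c" "chart_coord c y \<in> N" by auto
    let ?p = "(chart_coord c y, s c)" and ?z = "R (y, s)"
    have sc: "chart_vector A c y (s c) = s" using c y s by (simp add: chart_vector_coord)
    have "G (chart_coord c y) (s c) (s c) = g y s s"
      using c y sc by (simp add: G_def)
    also have "\<dots> \<le> a\<^sup>2"
      using norm a unfolding riemannian_norm_def by (simp add: sqrt_le_D)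
    finally have p: "?p \<in> coord_dom c c"
      and le: "\<And>w. b\<^sup>2 * G (chart_coord c y) w w \<le> G (coord_R c c ?p) (coord_DR c c ?p w) (coord_DR c c ?p w)"
      using est[OF y(2)] by blast+
    \<comment> \<open>Membership in \<open>coord_dom c c\<close> says precisely that the image point
      stays in the chart \<open>c\<close>.\<close>
    have z: "?z \<in> chart_dom c" using p c y sc by (simp add: in_coord_dom)
    have DR: "retraction_diff A R y s (chart_vector A c y w) = chart_vector A c ?z (coord_DR c c ?p w)" for w
      using retraction_diff_coord[OF c(1) y(1) c(1), of "s c" w] z sc by simp
    have "y \<in> points A" "?z \<in> points A" using c y z by (auto simp: points_def)
    then have ip: "inner_product_on (tangent_space A y) (g y)" "inner_product_on (tangent_space A ?z) (g ?z)"
      using g by (auto simp: riemannian_metric_def)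
    show "b \<le> sigma_min_diff A g R y s"
      unfolding sigma_min_diff_def
    proof (rule sigma_min_ge[OF ip linear_chart_vector[OF c(1) y(1)] inj_chart_vector[OF c(1) y(1)]
          range_chart_vector[OF c(1) y(1)]])
      show "linear (\<lambda>w. retraction_diff A R y s (chart_vector A c y w))"
        unfolding DR using linear_compose[OF linear_coord_DR[OF c(1) c(1) p] linear_chart_vector[OF c(1) z]]
        by (simp add: comp_def)
      show "retraction_diff A R y s (chart_vector A c y w) \<in> tangent_space A ?z" for w
        unfolding DR by (rule chart_vector_in[OF c(1) z])
      show "b \<ge> 0" using b by simp
      show "b\<^sup>2 * g y (chart_vector A c y w) (chart_vector A c y w)
        \<le> g ?z (retraction_diff A R y s (chart_vector A c y w)) (retraction_diff A R y s (chart_vector A c y w))" for w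
        using le[of w] c y z sc unfolding DR by (simp add: G_def coord_R_eq)
    qed
  qed
qed

end

section \<open>From local bounds to a uniform radius on a compact set\<close>

theorem theorem7:
  fixes A :: "('a, 'e::euclidean_space) atlas"
    and g :: "('a, 'e) metric"
    and R :: "'a \<times> ('a, 'e) tangent \<Rightarrow> 'a"
    and U :: "'a set"
    and b :: real
  assumes "riemannian_manifold A g"
    and "manifold_retraction A R"
    and "compactin (atlas_topology A) U"
    and "U \<noteq> {}"
    and "0 < b" and "b < 1"
  shows "\<exists>a>0.
    (\<forall>x\<in>U. \<forall>s\<in>tangent_space A x. riemannian_norm g x s \<le> a \<longrightarrow> sigma_min_diff A g R x s \<ge> b) \<and>
    (\<forall>(x :: nat \<Rightarrow> 'a) (s :: nat \<Rightarrow> ('a, 'e) tangent).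
        (\<forall>k. x k \<in> U \<and> s k \<in> tangent_space A (x k)) \<longrightarrow>
        (\<forall>k. riemannian_norm g (x k) (s k) \<le> a \<longrightarrow> sigma_min_diff A g R (x k) (s k) \<ge> b))"
proof -
  have A: "smooth_atlas A" and g: "riemannian_metric A g"
    using assms(1) by (auto simp: riemannian_manifold_def smooth_manifold_def)
  interpret retraction_atlas A R
    by unfold_locales (use A assms(2) in auto)
  have UA: "U \<subseteq> points A"
    using compactin_subset_topspace[OF assms(3)] by (simp add: topspace_atlas)
  have "\<exists>V a. openin (atlas_topology A) V \<and> x \<in> V \<and> a > 0 \<and>
      (\<forall>y\<in>V. \<forall>s\<in>tangent_space A y. riemannian_norm g y s \<le> a \<longrightarrow> b \<le> sigma_min_diff A g R y s)"
    if "x \<in> U" for x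
    using local_bound[OF g _ assms(5,6), of x] that UA by (metis subsetD)
  then obtain V r where V: "\<And>x. x \<in> U \<Longrightarrow> openin (atlas_topology A) (V x)" "\<And>x. x \<in> U \<Longrightarrow> x \<in> V x"
    and r: "\<And>x. x \<in> U \<Longrightarrow> r x > 0"
    and bound: "\<And>x y s. x \<in> U \<Longrightarrow> y \<in> V x \<Longrightarrow> s \<in> tangent_space A y \<Longrightarrow>
      riemannian_norm g y s \<le> r x \<Longrightarrow> b \<le> sigma_min_diff A g R y s"
    by metis
  have "\<forall>W\<in>V ` U. openin (atlas_topology A) W" "U \<subseteq> \<Union>(V ` U)"
    using V by auto
  then obtain \<F> where F: "finite \<F>" "\<F> \<subseteq> V ` U" "U \<subseteq> \<Union>\<F>"
    using assms(3) unfolding compactin_def by meson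
  then obtain T where T: "finite T" "T \<subseteq> U" "\<F> = V ` T"
    by (metis finite_subset_image)
  \<comment> \<open>The smallest of the finitely many radii of the subcover. Since \<open>U\<close>
    is nonempty, so is \<open>T\<close>, and the minimum is attained and positive.\<close>
  define a where "a = Min (r ` T)"
  have "T \<noteq> {}" using F T assms(4) by auto
  then have "a > 0" using T r by (auto simp: a_def)
  have a: "b \<le> sigma_min_diff A g R x s"
    if "x \<in> U" "s \<in> tangent_space A x" "riemannian_norm g x s \<le> a" for x s
  proof -
    obtain t where t: "t \<in> T" "x \<in> V t" using F T \<open>x \<in> U\<close> by blast
    then have "a \<le> r t" using T by (simp add: a_def)
    then show ?thesis using bound[of t x s] t T that by auto
  qed
  show ?thesis
    \<comment> \<open>The claim on sequences is the uniform bound applied to each pair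
      \<open>x k\<close>, \<open>s k\<close>.\<close>
    using \<open>a > 0\<close> a by (intro exI[of _ a]) blast
qed

end
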